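(* Let $\mu\in\mathbb{R}$ and $\sigma>0$, and let $X$ have the log-normal distribution with parameters $\mu$ and $\sigma$, i.e. with density $\frac{1}{x\sigma\sqrt{2\pi}}e^{-\frac12\left(\frac{\ln(x)-\mu}{\sigma}\right)^2}$ for $x>0$ and $0$ for $x\le 0$. Let $F$ be the cumulative distribution function of the standard normal distribution and, for $r>0$, put $$p_1=\frac{\ln(r)-\mu-2\sigma^2}{\sigma},\qquad p_2=\frac{\ln(r)-\mu-\sigma^2}{\sigma},\qquad p_3=\frac{\ln(r)-\mu}{\sigma}.$$ Then for every real $r>0$, the first-order, complementary and second-order loss functions of $X$ are $$L_1(r)=e^{\mu+\frac{\sigma^2}{2}}[1-F(p_2)]-r\,[1-F(p_3)],$$ $$L_c(r)=r\,F(p_3)-e^{\mu+\frac{\sigma^2}{2}}F(p_2),$$ $$L_2(r)=\frac{r^2}{2}[1-F(p_3)]-re^{\mu+\frac{\sigma^2}{2}}[1-F(p_2)]+\frac{e^{2(\mu+\sigma^2)}}{2}[1-F(p_1)].$$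
   Context: For a real random variable $X$ with probability density function $g$, the first-order loss function is $L_1(r)=\int_r^\infty(x-r)g(x)\,dx$, the complementary loss function is $L_c(r)=\int_{-\infty}^r(r-x)g(x)\,dx$, and the second-order loss function is $L_2(r)=\frac12\int_r^\infty(x-r)^2g(x)\,dx$. *)

theory Defs
  imports "HOL-Probability.Probability"
begin

definition lognormal_density :: "real \<Rightarrow> real \<Rightarrow> real \<Rightarrow> real" where
  "lognormal_density \<mu> \<sigma> x =
     (if x > 0 then 1 / (x * \<sigma> * sqrt (2 * pi)) * exp (- (1/2) * ((ln x - \<mu>) / \<sigma>)\<^sup>2) else 0)"

definition std_normal_cdf :: "real \<Rightarrow> real" where
  "std_normal_cdf = cdf (density lborel std_normal_density)"

(* A probability density is determined by X only up to a Lebesgue null set; the Radon-Nikodym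
   derivative of the law of X selects a version. Lemma pdf_AE_eq and the lemmas *_loss_eq
   show that the loss functions below do not depend on this choice. *)
definition pdf :: "'a measure \<Rightarrow> ('a \<Rightarrow> real) \<Rightarrow> real \<Rightarrow> real" where
  "pdf M X x = enn2real (RN_deriv lborel (distr M lborel X) x)"

definition first_order_loss :: "'a measure \<Rightarrow> ('a \<Rightarrow> real) \<Rightarrow> real \<Rightarrow> real" where
  "first_order_loss M X r = (LINT x:{r..}|lborel. (x - r) * pdf M X x)"

definition complementary_loss :: "'a measure \<Rightarrow> ('a \<Rightarrow> real) \<Rightarrow> real \<Rightarrow> real" where
  "complementary_loss M X r = (LINT x:{..r}|lborel. (r - x) * pdf M X x)"

definition second_order_loss :: "'a measure \<Rightarrow> ('a \<Rightarrow> real) \<Rightarrow> real \<Rightarrow> real" where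
  "second_order_loss M X r = 1/2 * (LINT x:{r..}|lborel. (x - r)\<^sup>2 * pdf M X x)"

lemma pdf_measurable [measurable]: "pdf M X \<in> borel_measurable lborel"
  unfolding pdf_def by measurable

lemma pdf_AE_eq:
  assumes "distributed M lborel X (\<lambda>x. ennreal (g x))" and "\<And>x. 0 \<le> g x"
  shows "AE x in lborel. pdf M X x = g x"
proof -
  have "AE x in lborel. ennreal (g x) = RN_deriv lborel (distr M lborel X) x"
    using assms(1) by (intro sigma_finite_measure.RN_deriv_unique[OF sigma_finite_lborel]) (auto simp: distributed_def)
  then show ?thesis
    by eventually_elim (metis pdf_def enn2real_ennreal assms(2))
qed

lemma set_integral_pdf_eq:
  assumes d: "distributed M lborel X (\<lambda>x. ennreal (g x))" and nn: "\<And>x. 0 \<le> g x"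
    and [measurable]: "h \<in> borel_measurable borel" "A \<in> sets borel"
  shows "(LINT x:A|lborel. h x * pdf M X x) = (LINT x:A|lborel. h x * g x)"
proof -
  have "(\<lambda>x. enn2real (ennreal (g x))) \<in> borel_measurable lborel"
    using d by (intro borel_measurable_enn2real) (simp add: distributed_def)
  then have [measurable]: "g \<in> borel_measurable borel" using nn by simp
  show ?thesis
    unfolding set_lebesgue_integral_def
    by (rule integral_cong_AE) (measurable, use pdf_AE_eq[OF d nn] in eventually_elim, simp)
qed

lemma first_order_loss_eq:
  assumes "distributed M lborel X (\<lambda>x. ennreal (g x))" and "\<And>x. 0 \<le> g x"
  shows "first_order_loss M X r = (LINT x:{r..}|lborel. (x - r) * g x)"
  unfolding first_order_loss_def by (rule set_integral_pdf_eq[OF assms]) auto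

lemma complementary_loss_eq:
  assumes "distributed M lborel X (\<lambda>x. ennreal (g x))" and "\<And>x. 0 \<le> g x"
  shows "complementary_loss M X r = (LINT x:{..r}|lborel. (r - x) * g x)"
  unfolding complementary_loss_def by (rule set_integral_pdf_eq[OF assms]) auto

lemma second_order_loss_eq:
  assumes "distributed M lborel X (\<lambda>x. ennreal (g x))" and "\<And>x. 0 \<le> g x"
  shows "second_order_loss M X r = 1/2 * (LINT x:{r..}|lborel. (x - r)\<^sup>2 * g x)"
proof -
  have "(LINT x:{r..}|lborel. (x - r)\<^sup>2 * pdf M X x) = (LINT x:{r..}|lborel. (x - r)\<^sup>2 * g x)"
    by (rule set_integral_pdf_eq[OF assms]) auto
  then show ?thesis unfolding second_order_loss_def by simp
qed

end

(* Completing the square shows that, up to the factor exp (k mu + k^2 sigma^2 / 2), the function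
   x^k * lognormal_density mu sigma x is the derivative of x |-> F ((ln x - mu - k sigma^2) / sigma).
   Its truncated moments for k = 0, 1, 2 therefore follow from the fundamental theorem of calculus,
   and the three loss functions are linear combinations of these moments. *)
theory Submission
  imports Defs "HOL-Real_Asymp.Real_Asymp"
begin

lemma real_distribution_std_normal: "real_distribution (density lborel std_normal_density)"
  by (intro real_distribution.intro real_distribution_axioms.intro prob_space_normal_density) auto

lemma std_normal_cdf_at_top: "(std_normal_cdf \<longlongrightarrow> 1) at_top"
  unfolding std_normal_cdf_def
  by (rule real_distribution.cdf_lim_at_top_prob[OF real_distribution_std_normal])

lemma std_normal_cdf_at_bot: "(std_normal_cdf \<longlongrightarrow> 0) at_bot"
  unfolding std_normal_cdf_def
  using real_distribution.finite_borel_measure_M[OF real_distribution_std_normal]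
  by (rule finite_borel_measure.cdf_lim_at_bot)

lemma isCont_normal_density: "s \<noteq> 0 \<Longrightarrow> isCont (normal_density m s) x"
  unfolding normal_density_def by (intro continuous_intros) auto

text \<open>The difference is the mass of the half-open interval \<open>{a<..b}\<close>. Since the
  density is nonnegative, this mass is a Bochner integral, and the endpoints do not matter for the
  interval integral. The degenerate case is split off because the first equation is obtained from a
  strict inequality.\<close>

lemma std_normal_cdf_diff:
  assumes "a \<le> b"
  shows "std_normal_cdf b - std_normal_cdf a = (LBINT x=a..b. std_normal_density x)"
proof (cases "a = b")
  case False
  interpret real_distribution "density lborel std_normal_density"
    by (rule real_distribution_std_normal)
  have "std_normal_cdf b - std_normal_cdf a = measure (density lborel std_normal_density) {a<..b}"
    unfolding std_normal_cdf_def using False assms by (intro cdf_diff_eq) auto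
  also have "\<dots> = (LINT x:{a<..b}|lborel. std_normal_density x)"
    unfolding set_lebesgue_integral_def
    by (auto simp: measure_def emeasure_density integral_eq_nn_integral
        intro!: arg_cong[where f=enn2real] nn_integral_cong split: split_indicator)
  finally show ?thesis using assms by (simp add: interval_integral_Ioc)
qed simp

lemma DERIV_std_normal_cdf: "DERIV std_normal_cdf x :> std_normal_density x"
proof -
  \<comment> \<open>Any compact interval with \<open>x\<close> in its interior would serve: the
    fundamental theorem gives a derivative within the interval, and at an interior point this is the
    full derivative.\<close>
  let ?a = "x - 1" and ?b = "x + 1"
  have "((\<lambda>u. LBINT y=?a..u. std_normal_density y) has_vector_derivative std_normal_density x)
      (at x within {?a..?b})"
    by (intro interval_integral_FTC2)
       (auto intro!: continuous_at_imp_continuous_on isCont_normal_density)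
  then have "((\<lambda>u. std_normal_cdf ?a + (LBINT y=?a..u. std_normal_density y))
      has_vector_derivative std_normal_density x) (at x within {?a..?b})"
    by (auto intro!: derivative_eq_intros)
  then have "(std_normal_cdf has_vector_derivative std_normal_density x) (at x within {?a..?b})"
  proof (rule has_vector_derivative_transform[rotated 2])
    show "std_normal_cdf u = std_normal_cdf ?a + (LBINT y=?a..u. std_normal_density y)"
      if "u \<in> {?a..?b}" for u
      using std_normal_cdf_diff[of ?a u] that by simp
  qed simp
  moreover have "at x within {?a..?b} = at x"
    by (rule at_within_interior) simp
  ultimately show ?thesis
    unfolding has_real_derivative_iff_has_vector_derivative by metis
qed

lemma lognormal_density_nonneg: "\<sigma> > 0 \<Longrightarrow> 0 \<le> lognormal_density \<mu> \<sigma> x"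
  by (simp add: lognormal_density_def)

lemma lognormal_density_measurable [measurable]:
  "lognormal_density \<mu> \<sigma> \<in> borel_measurable borel"
  unfolding lognormal_density_def[abs_def] by measurable

text \<open>The half-line \<open>{0<..}\<close> is open, so near a positive point the case
  distinction disappears and the explicit formula decides.\<close>

lemma isCont_lognormal_density:
  assumes "\<sigma> > 0" "x > 0"
  shows "isCont (lognormal_density \<mu> \<sigma>) x"
proof -
  have "isCont (\<lambda>x. 1 / (x * \<sigma> * sqrt (2 * pi)) * exp (- (1/2) * ((ln x - \<mu>) / \<sigma>)\<^sup>2)) x"
    using assms by (intro continuous_intros) auto
  moreover have "\<forall>\<^sub>F y in nhds x. lognormal_density \<mu> \<sigma> y =
      1 / (y * \<sigma> * sqrt (2 * pi)) * exp (- (1/2) * ((ln y - \<mu>) / \<sigma>)\<^sup>2)"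
    using eventually_nhds_in_open[of "{0<..}" x] assms
    by (auto simp: lognormal_density_def elim!: eventually_mono)
  ultimately show ?thesis by (simp add: isCont_cong)
qed

text \<open>Writing \<open>x ^ k\<close> as \<open>exp (k * ln x)\<close> turns the product into a
  single exponential of a quadratic in \<open>ln x\<close>, whose square is then completed. The
  factor \<open>1 / (x * \<sigma>)\<close> stands apart because it is the derivative of the argument
  of the normal density, as the chain rule requires.\<close>

lemma power_times_lognormal_density:
  assumes "\<sigma> > 0" "x > 0"
  shows "x ^ k * lognormal_density \<mu> \<sigma> x =
    exp (k * \<mu> + (k * \<sigma>)\<^sup>2 / 2) * (std_normal_density ((ln x - \<mu> - k * \<sigma>\<^sup>2) / \<sigma>) * (1 / (x * \<sigma>)))"
proof -
  have "x ^ k = exp (k * ln x)"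
    using assms by (simp add: exp_of_nat_mult)
  moreover have "k * ln x + - (1/2) * ((ln x - \<mu>) / \<sigma>)\<^sup>2 =
      k * \<mu> + (k * \<sigma>)\<^sup>2 / 2 + - ((ln x - \<mu> - k * \<sigma>\<^sup>2) / \<sigma>)\<^sup>2 / 2"
    using assms by (simp add: field_simps power2_eq_square)
  ultimately have "x ^ k * exp (- (1/2) * ((ln x - \<mu>) / \<sigma>)\<^sup>2) =
      exp (k * \<mu> + (k * \<sigma>)\<^sup>2 / 2) * exp (- ((ln x - \<mu> - k * \<sigma>\<^sup>2) / \<sigma>)\<^sup>2 / 2)"
    by (metis exp_add)
  then show ?thesis
    using assms by (simp add: lognormal_density_def std_normal_density_def field_simps)
qed

lemma DERIV_lognormal_moment:
  assumes "\<sigma> > 0" "x > 0"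
  shows "DERIV (\<lambda>x. exp (k * \<mu> + (k * \<sigma>)\<^sup>2 / 2) * std_normal_cdf ((ln x - \<mu> - k * \<sigma>\<^sup>2) / \<sigma>)) x
    :> x ^ k * lognormal_density \<mu> \<sigma> x"
proof -
  have "DERIV (\<lambda>x. (ln x - \<mu> - k * \<sigma>\<^sup>2) / \<sigma>) x :> 1 / (x * \<sigma>)"
    using assms by (auto intro!: derivative_eq_intros)
  then show ?thesis
    unfolding power_times_lognormal_density[OF assms]
    by (intro DERIV_cmult DERIV_chain2[OF DERIV_std_normal_cdf])
qed

text \<open>The integrand is nonnegative, so finite limits of an antiderivative at both ends yield
  integrability together with the value. The exponential is the full moment of order
  \<open>k\<close>. Bundling both facts in \<open>has_bochner_integral\<close> lets the moments be
  combined linearly later.\<close>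

lemma lognormal_upper_moment:
  assumes "\<sigma> > 0" "r > 0"
  shows "has_bochner_integral lborel
    (\<lambda>x. indicator {r..} x * (x ^ k * lognormal_density \<mu> \<sigma> x))
    (exp (k * \<mu> + (k * \<sigma>)\<^sup>2 / 2) * (1 - std_normal_cdf ((ln r - \<mu> - k * \<sigma>\<^sup>2) / \<sigma>)))"
proof -
  let ?f = "\<lambda>x. x ^ k * lognormal_density \<mu> \<sigma> x"
  let ?c = "exp (k * \<mu> + (k * \<sigma>)\<^sup>2 / 2)"
  let ?G = "\<lambda>x. ?c * std_normal_cdf ((ln x - \<mu> - k * \<sigma>\<^sup>2) / \<sigma>)"
  have "filterlim (\<lambda>x. (ln x - \<mu> - k * \<sigma>\<^sup>2) / \<sigma>) at_top at_top"
    using assms by real_asymp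
  then have top: "(?G \<longlongrightarrow> ?c * 1) at_top"
    by (intro tendsto_intros filterlim_compose[OF std_normal_cdf_at_top])
  have right: "(?G \<longlongrightarrow> ?G r) (at_right r)"
    using DERIV_isCont[OF DERIV_lognormal_moment[OF assms]]
    by (auto simp: isCont_def intro: filterlim_at_split[THEN iffD1, THEN conjunct2])
  note ftc = interval_integral_FTC_nonneg[of "ereal r" \<infinity> ?G ?f "?G r" "?c * 1"]
  have *: "set_integrable lborel (einterval (ereal r) \<infinity>) ?f"
    "(LBINT x=ereal r..\<infinity>. ?f x) = ?c * 1 - ?G r"
    using assms top right
    by (intro ftc; (auto intro!: DERIV_lognormal_moment isCont_lognormal_density isCont_mult
          simp: ereal_tendsto_simps lognormal_density_nonneg)[1])+
  \<comment> \<open>The fundamental theorem speaks of the open ray; adding the null set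
    \<open>{r}\<close> changes nothing.\<close>
  have "has_bochner_integral lborel (\<lambda>x. indicator {r<..} x * ?f x) (?c * 1 - ?G r)"
    using * by (simp add: has_bochner_integral_iff set_integrable_def set_lebesgue_integral_def
        interval_lebesgue_integral_le_eq)
  moreover have "AE x in lborel. indicator {r<..} x * ?f x = indicator {r..} x * ?f x"
    using AE_lborel_singleton[of r] by eventually_elim (auto split: split_indicator)
  ultimately show ?thesis
    by (subst has_bochner_integral_cong_AE[symmetric]) (auto simp: algebra_simps)
qed

lemma lognormal_lower_moment:
  assumes "\<sigma> > 0" "r > 0"
  shows "has_bochner_integral lborel
    (\<lambda>x. indicator {..r} x * (x ^ k * lognormal_density \<mu> \<sigma> x))
    (exp (k * \<mu> + (k * \<sigma>)\<^sup>2 / 2) * std_normal_cdf ((ln r - \<mu> - k * \<sigma>\<^sup>2) / \<sigma>))"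
proof -
  let ?f = "\<lambda>x. x ^ k * lognormal_density \<mu> \<sigma> x"
  let ?c = "exp (k * \<mu> + (k * \<sigma>)\<^sup>2 / 2)"
  let ?G = "\<lambda>x. ?c * std_normal_cdf ((ln x - \<mu> - k * \<sigma>\<^sup>2) / \<sigma>)"
  \<comment> \<open>The lower limit of integration is 0, since the density vanishes on the rest of
    the left half-line. There the logarithm tends to minus infinity, so the antiderivative tends to
    0.\<close>
  have "filterlim (\<lambda>x. (ln x - \<mu> - k * \<sigma>\<^sup>2) / \<sigma>) at_bot (at_right 0)"
    using assms by real_asymp
  then have zero: "(?G \<longlongrightarrow> ?c * 0) (at_right 0)"
    by (intro tendsto_intros filterlim_compose[OF std_normal_cdf_at_bot])
  have left: "(?G \<longlongrightarrow> ?G r) (at_left r)"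
    using DERIV_isCont[OF DERIV_lognormal_moment[OF assms]]
    by (auto simp: isCont_def intro: filterlim_at_split[THEN iffD1, THEN conjunct1])
  note ftc = interval_integral_FTC_nonneg[of "ereal 0" "ereal r" ?G ?f "?c * 0" "?G r"]
  have *: "set_integrable lborel (einterval (ereal 0) (ereal r)) ?f"
    "(LBINT x=ereal 0..ereal r. ?f x) = ?G r - ?c * 0"
    using assms zero left
    by (intro ftc; (auto intro!: DERIV_lognormal_moment isCont_lognormal_density isCont_mult
          simp: ereal_tendsto_simps lognormal_density_nonneg)[1])+
  have "has_bochner_integral lborel (\<lambda>x. indicator {0<..<r} x * ?f x) (?G r - ?c * 0)"
    using * assms by (simp add: has_bochner_integral_iff set_integrable_def set_lebesgue_integral_def
        interval_lebesgue_integral_le_eq)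
  \<comment> \<open>The two sets differ by the null set \<open>{r}\<close> and by the points
    \<open>x \<le> 0\<close>, where the density is 0.\<close>
  moreover have "AE x in lborel. indicator {0<..<r} x * ?f x = indicator {..r} x * ?f x"
    using AE_lborel_singleton[of r]
    by eventually_elim (auto simp: lognormal_density_def split: split_indicator)
  ultimately show ?thesis
    by (subst has_bochner_integral_cong_AE[symmetric]) auto
qed

theorem mainTheorem7:
  fixes M :: "'a measure" and X :: "'a \<Rightarrow> real" and \<mu> \<sigma> r :: real and F :: "real \<Rightarrow> real"
    and p1 p2 p3 :: real
  assumes "prob_space M"
    and "\<sigma> > 0"
    and "distributed M lborel X (lognormal_density \<mu> \<sigma>)"
    and "r > 0"
  defines "F \<equiv> std_normal_cdf"
    and "p1 \<equiv> (ln r - \<mu> - 2 * \<sigma>\<^sup>2) / \<sigma>"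
    and "p2 \<equiv> (ln r - \<mu> - \<sigma>\<^sup>2) / \<sigma>"
    and "p3 \<equiv> (ln r - \<mu>) / \<sigma>"
  shows "first_order_loss M X r = exp (\<mu> + \<sigma>\<^sup>2 / 2) * (1 - F p2) - r * (1 - F p3) \<and>
    complementary_loss M X r = r * F p3 - exp (\<mu> + \<sigma>\<^sup>2 / 2) * F p2 \<and>
    second_order_loss M X r =
      r\<^sup>2 / 2 * (1 - F p3) - r * exp (\<mu> + \<sigma>\<^sup>2 / 2) * (1 - F p2)
        + exp (2 * (\<mu> + \<sigma>\<^sup>2)) / 2 * (1 - F p1)"
proof -
  let ?g = "lognormal_density \<mu> \<sigma>"
  let ?U = "\<lambda>k x. indicator {r..} x * (x ^ k * ?g x)"
  let ?L = "\<lambda>k x. indicator {..r} x * (x ^ k * ?g x)"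
  note nonneg = lognormal_density_nonneg[OF \<open>\<sigma> > 0\<close>]
  note upper = lognormal_upper_moment[OF \<open>\<sigma> > 0\<close> \<open>r > 0\<close>, of _ \<mu>]
  note lower = lognormal_lower_moment[OF \<open>\<sigma> > 0\<close> \<open>r > 0\<close>, of _ \<mu>]
  \<comment> \<open>The numbering runs backwards: the moments of order 0, 1, 2 belong to
    \<open>p3\<close>, \<open>p2\<close>, \<open>p1\<close>.\<close>
  have U0: "has_bochner_integral lborel (?U 0) (1 - F p3)"
    using upper[of 0] by (simp add: F_def p3_def)
  have U1: "has_bochner_integral lborel (?U 1) (exp (\<mu> + \<sigma>\<^sup>2 / 2) * (1 - F p2))"
    using upper[of 1] by (simp add: F_def p2_def)
  have U2: "has_bochner_integral lborel (?U 2) (exp (2 * (\<mu> + \<sigma>\<^sup>2)) * (1 - F p1))"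
    using upper[of 2] by (simp add: F_def p1_def power_mult_distrib)
  have L0: "has_bochner_integral lborel (?L 0) (F p3)"
    using lower[of 0] by (simp add: F_def p3_def)
  have L1: "has_bochner_integral lborel (?L 1) (exp (\<mu> + \<sigma>\<^sup>2 / 2) * F p2)"
    using lower[of 1] by (simp add: F_def p2_def)
  have "(LINT x:{r..}|lborel. (x - r) * ?g x) = (LINT x|lborel. ?U 1 x - r * ?U 0 x)"
    unfolding set_lebesgue_integral_def by (simp add: algebra_simps)
  also have "\<dots> = exp (\<mu> + \<sigma>\<^sup>2 / 2) * (1 - F p2) - r * (1 - F p3)"
    by (intro has_bochner_integral_integral_eq has_bochner_integral_diff
        has_bochner_integral_mult_right U0 U1)
  \<comment> \<open>The distribution of \<open>X\<close> enters here: the version \<open>pdf\<close>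
    of its density may be replaced by the explicit formula under the integral.\<close>
  finally have first: "first_order_loss M X r = \<dots>"
    by (simp add: first_order_loss_eq[OF assms(3) nonneg])
  have "(LINT x:{..r}|lborel. (r - x) * ?g x) = (LINT x|lborel. r * ?L 0 x - ?L 1 x)"
    unfolding set_lebesgue_integral_def by (simp add: algebra_simps)
  also have "\<dots> = r * F p3 - exp (\<mu> + \<sigma>\<^sup>2 / 2) * F p2"
    by (intro has_bochner_integral_integral_eq has_bochner_integral_diff
        has_bochner_integral_mult_right L0 L1)
  finally have complementary: "complementary_loss M X r = \<dots>"
    by (simp add: complementary_loss_eq[OF assms(3) nonneg])
  \<comment> \<open>Expanding the square brings in all three upper moments; the factor 1/2 is
    applied at the end.\<close>
  have "(LINT x:{r..}|lborel. (x - r)\<^sup>2 * ?g x) =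
      (LINT x|lborel. r\<^sup>2 * ?U 0 x - 2 * r * ?U 1 x + ?U 2 x)"
    unfolding set_lebesgue_integral_def
    by (intro Bochner_Integration.integral_cong) (auto simp: algebra_simps power2_eq_square)
  also have "\<dots> = r\<^sup>2 * (1 - F p3) - 2 * r * (exp (\<mu> + \<sigma>\<^sup>2 / 2) * (1 - F p2))
      + exp (2 * (\<mu> + \<sigma>\<^sup>2)) * (1 - F p1)"
    by (intro has_bochner_integral_integral_eq has_bochner_integral_add has_bochner_integral_diff
        has_bochner_integral_mult_right U0 U1 U2)
  finally have "second_order_loss M X r = 1/2 * \<dots>"
    by (simp add: second_order_loss_eq[OF assms(3) nonneg])
  then have "second_order_loss M X r =
      r\<^sup>2 / 2 * (1 - F p3) - r * exp (\<mu> + \<sigma>\<^sup>2 / 2) * (1 - F p2)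
        + exp (2 * (\<mu> + \<sigma>\<^sup>2)) / 2 * (1 - F p1)"
    by (simp add: field_simps)
  with first complementary show ?thesis by blast
qed

end
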